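(* Let $G$ be a finite group. Then $\mathcal{P}_E^*(G)$ is regular if and only if $\mathcal{P}_E^*(G)$ is strongly regular.
   Context: For a finite group $G$ with identity $e$, the enhanced power graph $\mathcal{P}_E(G)$ is the simple undirected graph with vertex set $G$ in which two distinct vertices $x,y$ are adjacent if and only if $x,y\in\langle z\rangle$ for some $z\in G$. The proper enhanced power graph $\mathcal{P}_E^*(G)$ is the subgraph of $\mathcal{P}_E(G)$ induced by $G\setminus\{e\}$. A graph is $k$-regular if every vertex has degree $k$, and regular if it is $k$-regular for some $k$. A graph is strongly regular if there are parameters $(n,k,\lambda,\mu)$ such that it is a $k$-regular graph on $n$ vertices in which each pair of adjacent vertices has exactly $\lambda$ common neighbours and each pair of (distinct) non-adjacent vertices has exactly $\mu$ common neighbours; in particular complete graphs and graphs without edges count as strongly regular (the condition on a type of pair that does not occur is vacuous). *)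

theory Defs
  imports "HOL-Algebra.Generated_Groups" "Graph_Theory.Pair_Digraph" "Graph_Theory.Digraph_Component"
begin

text \<open>
  As in the Graph Theory library, a finite simple undirected graph is a finite, loopfree,
  symmetric digraph without parallel arcs (locale \<^locale>\<open>graph\<close>): an edge between \<open>x\<close> and \<open>y\<close>
  is the pair of arcs \<open>(x, y)\<close> and \<open>(y, x)\<close>.
\<close>

definition enhanced_power_graph :: "('a, 'b) monoid_scheme \<Rightarrow> 'a pair_pre_digraph" where
  "enhanced_power_graph G =
     \<lparr> pverts = carrier G,
       parcs = {(x, y). x \<in> carrier G \<and> y \<in> carrier G \<and> x \<noteq> y \<and>
                  (\<exists>z \<in> carrier G. x \<in> generate G {z} \<and> y \<in> generate G {z})} \<rparr>"

definition proper_enhanced_power_graph ::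
    "('a, 'b) monoid_scheme \<Rightarrow> ('a, 'a \<times> 'a) pre_digraph" where
  "proper_enhanced_power_graph G =
     with_proj (enhanced_power_graph G) \<restriction> (carrier G - {\<one>\<^bsub>G\<^esub>})"

text \<open>
  The following notions are meant for a \<^locale>\<open>graph\<close>, where arcs come in opposite pairs, so that
  the out-degree of a vertex is its degree in the undirected graph.
\<close>

definition k_regular :: "nat \<Rightarrow> ('v, 'e) pre_digraph \<Rightarrow> bool" where
  "k_regular k H \<longleftrightarrow> (\<forall>v \<in> verts H. out_degree H v = k)"

definition regular_graph :: "('v, 'e) pre_digraph \<Rightarrow> bool" where
  "regular_graph H \<longleftrightarrow> (\<exists>k. k_regular k H)"

definition common_neighbours :: "('v, 'e) pre_digraph \<Rightarrow> 'v \<Rightarrow> 'v \<Rightarrow> 'v set" where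
  "common_neighbours H u v = {w \<in> verts H. dominates H u w \<and> dominates H v w}"

definition srg_with_parameters ::
    "nat \<Rightarrow> nat \<Rightarrow> nat \<Rightarrow> nat \<Rightarrow> ('v, 'e) pre_digraph \<Rightarrow> bool" where
  "srg_with_parameters n k l m H \<longleftrightarrow>
     card (verts H) = n \<and> k_regular k H \<and>
     (\<forall>u \<in> verts H. \<forall>v \<in> verts H. dominates H u v \<longrightarrow> card (common_neighbours H u v) = l) \<and>
     (\<forall>u \<in> verts H. \<forall>v \<in> verts H. u \<noteq> v \<and> \<not> dominates H u v \<longrightarrow>
        card (common_neighbours H u v) = m)"

definition strongly_regular_graph :: "('v, 'e) pre_digraph \<Rightarrow> bool" where
  "strongly_regular_graph H \<longleftrightarrow> (\<exists>n k l m. srg_with_parameters n k l m H)"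

lemma graph_enhanced_power_graph:
  assumes "finite (carrier G)"
  shows "pair_graph (enhanced_power_graph G)"
proof -
  have "finite (parcs (enhanced_power_graph G))"
    by (rule finite_subset[of _ "carrier G \<times> carrier G"])
      (use assms in \<open>auto simp: enhanced_power_graph_def\<close>)
  then show ?thesis
    using assms
    by unfold_locales (auto simp: enhanced_power_graph_def symmetric_def sym_def)
qed

lemma graph_proper_enhanced_power_graph:
  assumes "finite (carrier G)"
  shows "graph (proper_enhanced_power_graph G)"
proof -
  let ?E = "with_proj (enhanced_power_graph G)"
  interpret E: graph ?E
    using pair_graph.pair_graphD_graph[OF graph_enhanced_power_graph[OF assms]] .
  have "finite (carrier G - {\<one>\<^bsub>G\<^esub>})"
    using assms by simp
  then show ?thesis
    unfolding proper_enhanced_power_graph_def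
    using E.finite_arcs E.no_loops E.no_multi_arcs E.sym_arcs
    by unfold_locales (auto simp: induce_subgraph_def symmetric_def sym_def arcs_ends_def arc_to_ends_def)
qed

end

theory Submission
  imports Defs
begin

text \<open>
  Write \<open>N[x]\<close> for the closed neighbourhood of a non-identity element \<open>x\<close>: it consists of the
  non-identity elements that share a cyclic subgroup with \<open>x\<close>.  Among the cyclic subgroups
  containing \<open>x\<close> let \<open>\<langle>m\<rangle>\<close> be one of largest order.  A cyclic subgroup through \<open>m\<close> contains \<open>\<langle>m\<rangle>\<close>,
  hence \<open>x\<close>, hence equals \<open>\<langle>m\<rangle>\<close> by maximality; so \<open>N[m] = \<langle>m\<rangle> - {e}\<close>.  On the other hand
  \<open>\<langle>m\<rangle> - {e} \<subseteq> N[x]\<close>.  In a regular graph the two closed neighbourhoods have equal size, so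
  \<open>N[x] = \<langle>m\<rangle> - {e}\<close>, which is a clique (\<open>closed_neighbourhood_cyclic\<close>).

  Neighbourhoods being cliques means that adjacency of distinct vertices is transitive, so the graph
  is a disjoint union of complete graphs; if it is also regular of degree \<open>k\<close>, then adjacent vertices have \<open>k - 1\<close> common neighbours and
  distinct non-adjacent ones have none (\<open>srg_if_regular_if_trans\<close>).  The converse is part of the
  definition of strong regularity.
\<close>

lemma (in nomulti_digraph) out_degree_eq_card_dominated:
  "out_degree G v = card {w. dominates G v w}"
proof -
  have "head G ` out_arcs G v = {w. dominates G v w}"
    by (auto simp: arcs_ends_def arc_to_ends_def image_iff)
  moreover have "inj_on (head G) (out_arcs G v)"
    using no_multi_arcs by (auto simp: inj_on_def arc_to_ends_def)
  ultimately show ?thesis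
    by (metis card_image out_degree_def)
qed

text \<open>
  The common neighbours of adjacent \<open>u\<close> and \<open>v\<close> are the neighbours of \<open>u\<close> other than \<open>v\<close>.  For
  \<open>k = 0\<close> there are no adjacent pairs, so truncated subtraction in \<open>k - 1\<close> is harmless.
\<close>

lemma (in graph) srg_if_regular_if_trans:
  assumes reg: "k_regular k G"
    and trans: "\<And>u v w. dominates G u w \<Longrightarrow> dominates G w v \<Longrightarrow> u \<noteq> v \<Longrightarrow> dominates G u v"
  shows "srg_with_parameters (card (verts G)) k (k - 1) 0 G"
proof -
  have sym: "dominates G v u" if "dominates G u v" for u v
    using that by (rule graph_symmetric)
  have adjacent: "card (common_neighbours G u v) = k - 1" if "u \<in> verts G" "dominates G u v" for u v
  proof -
    have "common_neighbours G u v = {w. dominates G u w} - {v}"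
    proof (intro equalityI subsetI)
      fix w assume "w \<in> {w. dominates G u w} - {v}"
      then show "w \<in> common_neighbours G u v"
        using trans[OF sym[OF that(2)]] adj_in_verts(2) by (auto simp: common_neighbours_def)
    qed (auto simp: common_neighbours_def dest: adj_not_same)
    moreover have "card {w. dominates G u w} = k"
      using reg that(1) by (simp add: k_regular_def out_degree_eq_card_dominated)
    ultimately show ?thesis
      using that(2) by (simp add: card_Diff_singleton)
  qed
  have "common_neighbours G u v = {}" if "u \<noteq> v" "\<not> dominates G u v" for u v
    using that trans[OF _ sym] unfolding common_neighbours_def by blast
  then show ?thesis
    using reg adjacent by (simp add: srg_with_parameters_def)
qed

lemma dominates_proper_enhanced_power_graph:
  "dominates (proper_enhanced_power_graph G) x y \<longleftrightarrow>
     x \<in> carrier G - {\<one>\<^bsub>G\<^esub>} \<and> y \<in> carrier G - {\<one>\<^bsub>G\<^esub>} \<and> x \<noteq> y \<and>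
     (\<exists>z \<in> carrier G. x \<in> generate G {z} \<and> y \<in> generate G {z})"
  by (auto simp: proper_enhanced_power_graph_def enhanced_power_graph_def induce_subgraph_def
      arcs_ends_def arc_to_ends_def image_iff)

lemma verts_proper_enhanced_power_graph:
  "verts (proper_enhanced_power_graph G) = carrier G - {\<one>\<^bsub>G\<^esub>}"
  by (simp add: proper_enhanced_power_graph_def)

text \<open>
  The generator \<open>m\<close> is chosen to make \<open>\<langle>m\<rangle>\<close> as large as possible among the cyclic subgroups through
  \<open>x\<close>.  Then the closed neighbourhood of \<open>m\<close> lies in \<open>\<langle>m\<rangle> - {\<one>}\<close>, which lies in that of \<open>x\<close>, and
  regularity turns this chain of inclusions into equalities.
\<close>

lemma (in group) closed_neighbourhood_cyclic:
  assumes fin: "finite (carrier G)"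
    and reg: "k_regular k (proper_enhanced_power_graph G)"
    and x: "x \<in> carrier G - {\<one>}"
  obtains m where "m \<in> carrier G"
    and "insert x {y. dominates (proper_enhanced_power_graph G) x y} = generate G {m} - {\<one>}"
proof -
  let ?P = "proper_enhanced_power_graph G"
  let ?gen = "\<lambda>z. generate G {z}"
  let ?N = "\<lambda>x. insert x {y. dominates ?P x y}"
  interpret P: graph ?P
    using graph_proper_enhanced_power_graph[OF fin] .
  have self: "z \<in> ?gen z" for z
    by (simp add: generate.incl)
  have gen_carrier: "?gen z \<subseteq> carrier G" if "z \<in> carrier G" for z
    using that by (simp add: generate_incl)
  have gen_mono: "?gen z \<subseteq> ?gen z'" if "z' \<in> carrier G" "z \<in> ?gen z'" for z z'
    using that generate_subgroup_incl[OF _ generate_is_subgroup[of "{z'}"], of "{z}"] by simp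
  have bound: "\<forall>z. z \<in> carrier G \<and> x \<in> ?gen z \<longrightarrow> card (?gen z) < Suc (card (carrier G))"
    using fin gen_carrier by (simp add: card_mono less_Suc_eq_le)
  have "\<exists>m. (m \<in> carrier G \<and> x \<in> ?gen m) \<and>
      (\<forall>z. z \<in> carrier G \<and> x \<in> ?gen z \<longrightarrow> card (?gen z) \<le> card (?gen m))"
    by (rule ex_has_greatest_nat[OF _ bound, of x]) (use x self in simp)
  then obtain m where m: "m \<in> carrier G" "x \<in> ?gen m"
    and max: "\<And>z. z \<in> carrier G \<Longrightarrow> x \<in> ?gen z \<Longrightarrow> card (?gen z) \<le> card (?gen m)"
    by blast
  have m_nontrivial: "m \<noteq> \<one>"
    using m(2) x generate_one by auto
  have card_N: "card (?N y) = Suc k" if "y \<in> carrier G - {\<one>}" for y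
  proof -
    have "finite {w. dominates ?P y w}"
      using fin by (rule rev_finite_subset) (auto simp: dominates_proper_enhanced_power_graph)
    moreover have "card {w. dominates ?P y w} = k"
      using reg that P.out_degree_eq_card_dominated
      by (simp add: k_regular_def verts_proper_enhanced_power_graph)
    ultimately show ?thesis
      by (simp add: dominates_proper_enhanced_power_graph)
  qed
  have N_m: "?N m \<subseteq> ?gen m - {\<one>}"
  proof
    fix y assume "y \<in> ?N m"
    then consider "y = m" | z where "y \<noteq> \<one>" "z \<in> carrier G" "m \<in> ?gen z" "y \<in> ?gen z"
      by (auto simp: dominates_proper_enhanced_power_graph)
    then show "y \<in> ?gen m - {\<one>}"
    proof cases
      case 1
      then show ?thesis
        using self m_nontrivial by simp
    next
      case 2
      have sub: "?gen m \<subseteq> ?gen z"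
        using 2 gen_mono by blast
      have "finite (?gen z)"
        using finite_subset[OF gen_carrier fin] 2 by blast
      then have "?gen m = ?gen z"
        using sub max[of z] 2(2) m(2) by (intro card_seteq) auto
      with 2 show ?thesis by simp
    qed
  qed
  have N_x: "?gen m - {\<one>} \<subseteq> ?N x"
    using m x gen_carrier[OF m(1)] by (auto simp: dominates_proper_enhanced_power_graph)
  have finite_gen: "finite (?gen m - {\<one>})"
    using finite_subset[OF gen_carrier[OF m(1)] fin] by simp
  have "finite (?N x)"
    using card_N[OF x] by (intro card_ge_0_finite) simp
  moreover have "card (?N x) \<le> card (?gen m - {\<one>})"
    using card_mono[OF finite_gen N_m] card_N[of m] card_N[OF x] m(1) m_nontrivial by simp
  ultimately have "?N x = ?gen m - {\<one>}"
    using card_seteq[OF _ N_x] by simp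
  with m(1) show ?thesis
    by (rule that)
qed

theorem theorem4p2:
  fixes G :: "('a, 'b) monoid_scheme"
  assumes "group G" and "finite (carrier G)"
  shows "regular_graph (proper_enhanced_power_graph G)
     \<longleftrightarrow> strongly_regular_graph (proper_enhanced_power_graph G)"
proof
  let ?P = "proper_enhanced_power_graph G"
  interpret group G by fact
  interpret P: graph ?P
    using graph_proper_enhanced_power_graph[OF assms(2)] .
  assume "regular_graph ?P"
  then obtain k where reg: "k_regular k ?P"
    by (auto simp: regular_graph_def)
  have "dominates ?P u v" if "dominates ?P u w" "dominates ?P w v" "u \<noteq> v" for u v w
  proof -
    have w: "w \<in> carrier G - {\<one>\<^bsub>G\<^esub>}"
      using that(2) by (simp add: dominates_proper_enhanced_power_graph)
    obtain m where m: "m \<in> carrier G"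
      and N: "insert w {y. dominates ?P w y} = generate G {m} - {\<one>\<^bsub>G\<^esub>}"
      using closed_neighbourhood_cyclic[OF assms(2) reg w] .
    have "dominates ?P w u"
      using that(1) by (rule P.graph_symmetric)
    then have "u \<in> generate G {m} - {\<one>\<^bsub>G\<^esub>}" "v \<in> generate G {m} - {\<one>\<^bsub>G\<^esub>}"
      using that(2) N by blast+
    then show ?thesis
      using that m by (auto simp: dominates_proper_enhanced_power_graph)
  qed
  then show "strongly_regular_graph ?P"
    using P.srg_if_regular_if_trans[OF reg] by (auto simp: strongly_regular_graph_def)
next
  assume "strongly_regular_graph (proper_enhanced_power_graph G)"
  then show "regular_graph (proper_enhanced_power_graph G)"
    by (auto simp: strongly_regular_graph_def srg_with_parameters_def regular_graph_def)
qed

end
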